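(* Let $q\in\mathbb{C}$ with $|q|<1$, fix a square root $q^{1/2}$ of $q$, and set $q^{m/2}=(q^{1/2})^m$ for integers $m\ge 0$. Let $$C_1(q)=\frac{f(-q^7, -q^{23})}{f(-q^{8}, -q^{22})},\quad C_2(q)=\frac{f(-q^6, -q^{24})}{f(-q^{9}, -q^{21})},\quad C_3(q)=\frac{f(-q^5, -q^{25})}{f(-q^{10}, -q^{20})},\quad C_4(q)=\frac{f(-q^4, -q^{26})}{f(-q^{11}, -q^{19})},$$ $$C_5(q)=\frac{f(-q^3, -q^{27})}{f(-q^{12}, -q^{18})},\quad C_6(q)=\frac{f(-q^2, -q^{28})}{f(-q^{13}, -q^{17})},\quad C_7(q)=\frac{f(-q, -q^{29})}{f(-q^{14}, -q^{16})}.$$ Then the following hold, where in each of (i)--(vii) either all upper signs or all lower signs are taken (so each is two identities): (i) $\dfrac{1}{C_1(q)} \mp q^{1/2}C_1(q)= \dfrac{f(\mp q^{1/2}, \mp q^{29/2})\, \varphi(\pm q^{15/2})}{f(-q^7, -q^8)\, \psi(q^{15})}$; (ii) $\dfrac{1}{C_2(q)} \mp q^{3/2}C_2(q)= \dfrac{f(\mp q^{3/2}, \mp q^{27/2})\, \varphi(\pm q^{15/2})}{f(-q^6, -q^9)\, \psi(q^{15})}$; (iii) $\dfrac{1}{C_3(q)} \mp q^{5/2}C_3(q)= \dfrac{f(\mp q^{5/2}, \mp q^{25/2})\, \varphi(\pm q^{15/2})}{f(-q^5, -q^{10})\, \psi(q^{15})}$; (iv) $\dfrac{1}{C_4(q)}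 \mp q^{7/2}C_4(q)= \dfrac{f(\mp q^{7/2}, \mp q^{23/2})\, \varphi(\pm q^{15/2})}{f(-q^4, -q^{11})\, \psi(q^{15})}$; (v) $\dfrac{1}{C_5(q)} \mp q^{9/2}C_5(q)= \dfrac{f(\mp q^{9/2}, \mp q^{21/2})\, \varphi(\pm q^{15/2})}{f(-q^3, -q^{12})\, \psi(q^{15})}$; (vi) $\dfrac{1}{C_6(q)} \mp q^{11/2}C_6(q)= \dfrac{f(\mp q^{11/2}, \mp q^{19/2})\, \varphi(\pm q^{15/2})}{f(-q^2, -q^{13})\, \psi(q^{15})}$; (vii) $\dfrac{1}{C_7(q)} \mp q^{13/2}C_7(q)= \dfrac{f(\mp q^{13/2}, \mp q^{17/2})\, \varphi(\pm q^{15/2})}{f(-q, -q^{14})\, \psi(q^{15})}$.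
   Context: Ramanujan's general theta function is $f(a,b)=\sum_{n=-\infty}^{\infty} a^{n(n+1)/2}b^{n(n-1)/2}$ for $|ab|<1$ (with the convention $0^0=1$). Also $\varphi(q)=f(q,q)=\sum_{n=-\infty}^\infty q^{n^2}$ and $\psi(q)=f(q,q^3)=\sum_{n=0}^{\infty} q^{n(n+1)/2}$ for $|q|<1$. *)

theory Defs
  imports "HOL-Analysis.Analysis"
begin

text \<open>
  The exponents $n(n+1)/2$ and $n(n-1)/2$ are nonnegative integers for every integer $n$, so
  both the division by 2 and the conversion to a natural number are exact; \<open>0 ^ 0 = 1\<close> holds
  for this power function. For $|ab| < 1$ the bilateral series converges absolutely, so the
  unconditional sum \<open>\<Sum>\<^sub>\<infinity>\<close> is its ordinary value; the definition is only meaningful there.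
\<close>

definition theta_f :: "complex \<Rightarrow> complex \<Rightarrow> complex" where
  "theta_f a b = (\<Sum>\<^sub>\<infinity>n::int. a ^ nat (n * (n + 1) div 2) * b ^ nat (n * (n - 1) div 2))"

definition theta_phi :: "complex \<Rightarrow> complex" where
  "theta_phi q = theta_f q q"

definition theta_psi :: "complex \<Rightarrow> complex" where
  "theta_psi q = theta_f q (q ^ 3)"

definition C1 :: "complex \<Rightarrow> complex" where
  "C1 q = theta_f (- (q ^ 7)) (- (q ^ 23)) / theta_f (- (q ^ 8)) (- (q ^ 22))"

definition C2 :: "complex \<Rightarrow> complex" where
  "C2 q = theta_f (- (q ^ 6)) (- (q ^ 24)) / theta_f (- (q ^ 9)) (- (q ^ 21))"

definition C3 :: "complex \<Rightarrow> complex" where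
  "C3 q = theta_f (- (q ^ 5)) (- (q ^ 25)) / theta_f (- (q ^ 10)) (- (q ^ 20))"

definition C4 :: "complex \<Rightarrow> complex" where
  "C4 q = theta_f (- (q ^ 4)) (- (q ^ 26)) / theta_f (- (q ^ 11)) (- (q ^ 19))"

definition C5 :: "complex \<Rightarrow> complex" where
  "C5 q = theta_f (- (q ^ 3)) (- (q ^ 27)) / theta_f (- (q ^ 12)) (- (q ^ 18))"

definition C6 :: "complex \<Rightarrow> complex" where
  "C6 q = theta_f (- (q ^ 2)) (- (q ^ 28)) / theta_f (- (q ^ 13)) (- (q ^ 17))"

definition C7 :: "complex \<Rightarrow> complex" where
  "C7 q = theta_f (- q) (- (q ^ 29)) / theta_f (- (q ^ 14)) (- (q ^ 16))"

end

theory Submission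
  imports Defs
begin

text \<open>
  Put \<open>t = \<epsilon> s\<close>, so that \<open>t\<^sup>2 = q\<close> and every half-integral power of \<open>q\<close> in the statement,
  together with its sign, is an odd power of \<open>t\<close>. With \<open>p = t ^ 15\<close> and \<open>z = t ^ m\<close>, where
  \<open>m = 1, 3, \<dots>, 13\<close>, the seven quotients become \<open>A / B\<close> for
  \<open>A = f(-p/z, -p\<^sup>3 z)\<close> and \<open>B = f(-p z, -p\<^sup>3/z)\<close>, and all the identities are instances of one
  identity in two free variables,
  \<open>B/A - z A/B = f(-z, -p\<^sup>2/z) \<phi>(p) / (f(-p/z, -p z) \<psi>(p\<^sup>2))\<close>.

  It follows from separate evaluations of the numerator and the denominator of
  \<open>(B\<^sup>2 - z A\<^sup>2) / (A B)\<close>: the lemma \<open>theta_square_difference\<close> says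
  \<open>B\<^sup>2 - z A\<^sup>2 = f(-z, -p\<^sup>2/z) \<phi>(p)\<close> and \<open>theta_product\<close> says
  \<open>A B = f(-p/z, -p z) \<psi>(p\<^sup>2)\<close>. Both are rearrangements of series and are most transparent for
  the symmetric form \<open>J(p, z) = \<Sum>\<^sub>n p ^ (n\<^sup>2) z ^ n\<close>, that is \<open>f(p z, p/z)\<close>. The changes of
  variables \<open>(m, n) = (u + v, u - v)\<close> and \<open>(m, n) = (u + v + 1, u - v)\<close>, which between them
  reach each pair of integers once, turn the double series \<open>J(p, x) J(p, y)\<close> into products of
  theta series of base \<open>p\<^sup>2\<close> (\<open>theta_J_mult\<close>). For \<open>x = -z/p\<close>, \<open>y = 1\<close> this is already the
  numerator identity. For the denominator the two resulting summands share a factor, and what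
  remains is \<open>J(p, -z)\<close> split into its even and odd terms (\<open>theta_J_dissection\<close>).
\<close>

section \<open>The symmetric theta series\<close>

definition theta_J :: "complex \<Rightarrow> complex \<Rightarrow> complex" where
  "theta_J p z = (\<Sum>\<^sub>\<infinity>n::int. p powi n\<^sup>2 * z powi n)"

text \<open>
  The term is \<open>(r ^ n * y) ^ n\<close> and its base tends to 0, so the series is eventually dominated
  by a geometric one, however large \<open>y\<close> is.
\<close>
lemma summable_quadratic_exponent_nat:
  fixes r y :: real
  assumes "0 \<le> r" "r < 1" "0 \<le> y"
  shows "summable (\<lambda>n. r ^ n\<^sup>2 * y ^ n)"
proof -
  have "(\<lambda>n. r ^ n * y) \<longlonglongrightarrow> 0 * y"
    using assms by (intro tendsto_intros LIMSEQ_realpow_zero) auto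
  then have "eventually (\<lambda>n. r ^ n * y < 1 / 2) sequentially"
    by (intro order_tendstoD(2)[of _ 0]) auto
  then have "eventually (\<lambda>n. norm (r ^ n\<^sup>2 * y ^ n) \<le> (1 / 2) ^ n) sequentially"
  proof eventually_elim
    case (elim n)
    have "r ^ n\<^sup>2 * y ^ n = (r ^ n * y) ^ n"
      by (simp add: power_mult_distrib power_mult power2_eq_square)
    also have "\<dots> \<le> (1 / 2) ^ n"
      using elim assms by (intro power_mono) auto
    finally show ?case using assms by simp
  qed
  then show ?thesis
    by (rule summable_comparison_test_ev) (simp add: summable_geometric)
qed

lemma theta_J_abs_summable:
  fixes p z :: complex
  assumes "norm p < 1"
  shows "(\<lambda>n::int. norm (p powi n\<^sup>2 * z powi n)) summable_on UNIV"
proof -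
  let ?t = "\<lambda>n::int. norm (p powi n\<^sup>2 * z powi n)"
  have nat_part: "(\<lambda>n::nat. norm p ^ n\<^sup>2 * norm w ^ n) summable_on UNIV" for w :: complex
    using summable_quadratic_exponent_nat[of "norm p" "norm w"] assms
    by (subst summable_on_UNIV_nonneg_real_iff) auto
  have sq: "p powi (int n)\<^sup>2 = p ^ n\<^sup>2" for n
    by (metis of_nat_power power_int_of_nat)
  have "?t summable_on range int"
    using nat_part[of z]
    by (subst summable_on_reindex) (auto simp: o_def norm_mult norm_power sq)
  moreover have "?t summable_on range (\<lambda>n. - int n)"
    using nat_part[of "inverse z"]
    by (subst summable_on_reindex)
      (auto simp: o_def norm_mult norm_power norm_inverse power_int_minus inj_on_def sq power_inverse)
  ultimately have "?t summable_on (range int \<union> range (\<lambda>n. - int n))"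
    by (rule summable_on_union)
  also have "range int \<union> range (\<lambda>n. - int n) = UNIV"
    by (auto simp: image_iff) (metis int_cases2)
  finally show ?thesis .
qed

lemma theta_J_has_sum:
  assumes "norm p < 1"
  shows "((\<lambda>n::int. p powi n\<^sup>2 * z powi n) has_sum theta_J p z) UNIV"
  unfolding theta_J_def
  using abs_summable_summable[OF theta_J_abs_summable[OF assms]] by (rule has_sum_infsum)

lemma has_sum_mult_abs_summable:
  fixes f g :: "'a \<Rightarrow> complex"
  assumes f: "(f has_sum a) UNIV" "(\<lambda>n. norm (f n)) summable_on UNIV"
    and g: "(g has_sum b) UNIV" "(\<lambda>n. norm (g n)) summable_on UNIV"
  shows "((\<lambda>(m, n). f m * g n) has_sum a * b) UNIV"
proof -
  have "(\<lambda>x. norm (case x of (m, n) \<Rightarrow> f m * g n)) summable_on (UNIV \<times> UNIV)"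
    unfolding Infinite_Sum.abs_summable_on_Sigma_iff
    using f(2) g(2)
    by (auto simp: norm_mult infsum_cmult_right' abs_mult
        intro!: summable_on_cmult_right summable_on_cmult_left)
  then have "(\<lambda>(m, n). f m * g n) summable_on (UNIV \<times> UNIV)"
    by (rule abs_summable_summable)
  then have "((\<lambda>(m, n). f m * g n) has_sum a * b) (UNIV \<times> UNIV)"
    by (rule has_sum_SigmaI[rotated 2])
      (use f(1) g(1) in \<open>auto intro: has_sum_cmult_right has_sum_cmult_left\<close>)
  then show ?thesis by simp
qed

lemma theta_J_mult_has_sum:
  assumes "norm p < 1" "norm r < 1"
  shows "((\<lambda>(m::int, n::int). p powi m\<^sup>2 * x powi m * (r powi n\<^sup>2 * y powi n))
           has_sum theta_J p x * theta_J r y) UNIV"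
  using has_sum_mult_abs_summable[OF theta_J_has_sum theta_J_abs_summable
      theta_J_has_sum theta_J_abs_summable, OF assms(1,1,2,2)] .

text \<open>
  The reflection \<open>n \<mapsto> - n\<close> of the summation index; on \<open>theta_f\<close> it is the symmetry in the two
  arguments.
\<close>
lemma theta_J_inverse: "theta_J p (inverse z) = theta_J p z"
  unfolding theta_J_def
  by (rule infsum_reindex_bij_witness[of _ uminus uminus]) (auto simp: power_int_minus power_int_inverse)

section \<open>Dissection and multiplication\<close>

lemma powi_power: "(z ^ k) powi n = z powi (int k * n)" for z :: complex
  by (metis power_int_mult power_int_of_nat)

text \<open>
  Even indices \<open>2n\<close> contribute \<open>p ^ (4n\<^sup>2) y ^ (2n)\<close>; odd ones \<open>2n + 1\<close> contribute
  \<open>p ^ (4n\<^sup>2 + 4n + 1) y ^ (2n + 1)\<close>, whose linear part \<open>4n\<close> moves into the second argument.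
\<close>
lemma theta_J_dissection:
  assumes "p \<noteq> 0" "norm p < 1" "y \<noteq> 0"
  shows "theta_J p y = theta_J (p ^ 4) (y\<^sup>2) + p * y * theta_J (p ^ 4) (p ^ 4 * y\<^sup>2)"
proof -
  let ?t = "\<lambda>n::int. p powi n\<^sup>2 * y powi n"
  have p4: "norm (p ^ 4) < 1"
    using assms by (simp add: norm_power power_less_one_iff)
  have even: "(?t has_sum theta_J (p ^ 4) (y\<^sup>2)) (range (\<lambda>n. 2 * n))"
    using theta_J_has_sum[OF p4, of "y\<^sup>2"]
    by (subst has_sum_reindex) (auto simp: inj_on_def o_def powi_power power_mult_distrib)
  have eq: "p * y * ((p ^ 4) powi n\<^sup>2 * (p ^ 4 * y\<^sup>2) powi n) = ?t (2 * n + 1)" for n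
  proof -
    have "?t (2 * n + 1) = p powi (4 * n\<^sup>2 + 4 * n + 1) * y powi (2 * n + 1)"
      by (simp add: power2_eq_square algebra_simps)
    then show ?thesis
      using assms by (simp add: powi_power power_int_add power_int_mult_distrib)
  qed
  have odd: "(?t has_sum p * y * theta_J (p ^ 4) (p ^ 4 * y\<^sup>2)) (range (\<lambda>n. 2 * n + 1))"
    using has_sum_cmult_right[OF theta_J_has_sum[OF p4, of "p ^ 4 * y\<^sup>2"], of "p * y"]
    by (subst has_sum_reindex) (auto simp: inj_on_def o_def eq)
  have disj: "range (\<lambda>n::int. 2 * n) \<inter> range (\<lambda>n. 2 * n + 1) = {}"
    by (auto simp: image_iff) presburger
  have un: "range (\<lambda>n::int. 2 * n) \<union> range (\<lambda>n. 2 * n + 1) = UNIV"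
    by (auto simp: image_iff) presburger
  show ?thesis
    using has_sum_unique[OF theta_J_has_sum has_sum_Un_disjoint[OF even odd disj, unfolded un]] assms
    by simp
qed

text \<open>
  Pairs \<open>(m, n)\<close> with even sum are \<open>(u + v, u - v)\<close>, and there \<open>m\<^sup>2 + n\<^sup>2 = 2u\<^sup>2 + 2v\<^sup>2\<close>. Pairs with
  odd sum are \<open>(u + v + 1, u - v)\<close>, and there \<open>m\<^sup>2 + n\<^sup>2 = 2u\<^sup>2 + 2u + 2v\<^sup>2 + 2v + 1\<close>. Either way the
  quadratic form stays diagonal, so each half of the double series is again a product.
\<close>
lemma theta_J_mult:
  assumes "p \<noteq> 0" "norm p < 1" "x \<noteq> 0" "y \<noteq> 0"
  shows "theta_J p x * theta_J p y =
    theta_J (p\<^sup>2) (x * y) * theta_J (p\<^sup>2) (x / y) +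
    p * x * (theta_J (p\<^sup>2) (p\<^sup>2 * (x * y)) * theta_J (p\<^sup>2) (p\<^sup>2 * (x / y)))"
proof -
  let ?t = "\<lambda>(m::int, n::int). p powi m\<^sup>2 * x powi m * (p powi n\<^sup>2 * y powi n)"
  let ?E = "range (\<lambda>(u::int, v). (u + v, u - v))"
  let ?O = "range (\<lambda>(u::int, v). (u + v + 1, u - v))"
  have p2: "norm (p\<^sup>2) < 1"
    using assms by (simp add: norm_power power_less_one_iff)
  have eqE: "(p\<^sup>2) powi u\<^sup>2 * (x * y) powi u * ((p\<^sup>2) powi v\<^sup>2 * (x / y) powi v)
      = ?t (u + v, u - v)" for u v
  proof -
    have "(u + v)\<^sup>2 + (u - v)\<^sup>2 = 2 * u\<^sup>2 + 2 * v\<^sup>2"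
      by (simp add: power2_eq_square algebra_simps)
    then have "p powi (u + v)\<^sup>2 * p powi (u - v)\<^sup>2 = p powi (2 * u\<^sup>2) * p powi (2 * v\<^sup>2)"
      using assms by (simp flip: power_int_add)
    then show ?thesis
      using assms by (simp add: powi_power power_int_mult_distrib power_int_divide_distrib
          power_int_add power_int_diff)
  qed
  have eqO: "p * x * ((p\<^sup>2) powi u\<^sup>2 * (p\<^sup>2 * (x * y)) powi u
        * ((p\<^sup>2) powi v\<^sup>2 * (p\<^sup>2 * (x / y)) powi v))
      = ?t (u + v + 1, u - v)" for u v
  proof -
    have "(u + v + 1)\<^sup>2 + (u - v)\<^sup>2 = 1 + 2 * u\<^sup>2 + 2 * u + 2 * v\<^sup>2 + 2 * v"
      by (simp add: power2_eq_square algebra_simps)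
    then have "p powi (u + v + 1)\<^sup>2 * p powi (u - v)\<^sup>2
        = p * p powi (2 * u\<^sup>2) * p powi (2 * u) * p powi (2 * v\<^sup>2) * p powi (2 * v)"
      using assms by (simp add: power_int_add flip: power_int_add[of p "(u + v + 1)\<^sup>2"])
    then show ?thesis
      using assms by (simp add: powi_power power_int_mult_distrib power_int_divide_distrib
          power_int_add power_int_diff)
  qed
  have injE: "inj (\<lambda>(u::int, v). (u + v, u - v))" and injO: "inj (\<lambda>(u::int, v). (u + v + 1, u - v))"
    by (auto simp: inj_on_def)
  have E: "(?t has_sum theta_J (p\<^sup>2) (x * y) * theta_J (p\<^sup>2) (x / y)) ?E"
    using theta_J_mult_has_sum[OF p2 p2, of "x * y" "x / y"] injE
    by (subst has_sum_reindex) (simp_all add: o_def case_prod_unfold eqE)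
  have O: "(?t has_sum p * x * (theta_J (p\<^sup>2) (p\<^sup>2 * (x * y)) * theta_J (p\<^sup>2) (p\<^sup>2 * (x / y)))) ?O"
    using has_sum_cmult_right[OF theta_J_mult_has_sum[OF p2 p2, of "p\<^sup>2 * (x * y)" "p\<^sup>2 * (x / y)"],
        of "p * x"] injO
    by (subst has_sum_reindex) (simp_all only: o_def case_prod_unfold eqO fst_conv snd_conv)
  have disj: "?E \<inter> ?O = {}"
    by (auto simp: image_iff) presburger
  have un: "?E \<union> ?O = UNIV"
  proof -
    have "(m, n) \<in> ?E \<union> ?O" for m n :: int
    proof (cases "even (m + n)")
      case True
      then have "(m, n) = (\<lambda>(u, v). (u + v, u - v)) ((m + n) div 2, (m - n) div 2)"
        by (auto elim!: evenE) presburger+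
      then show ?thesis by blast
    next
      case False
      then have "(m, n) = (\<lambda>(u, v). (u + v + 1, u - v)) ((m + n - 1) div 2, (m - n - 1) div 2)"
        by auto presburger+
      then show ?thesis by blast
    qed
    then show ?thesis by auto
  qed
  show ?thesis
    using has_sum_unique[OF theta_J_mult_has_sum has_sum_Un_disjoint[OF E O disj, unfolded un]] assms
    by simp
qed

section \<open>Two identities for the general theta function\<close>

text \<open>
  The exponents \<open>k = n(n + 1)/2\<close> and \<open>l = n(n - 1)/2\<close> have sum \<open>n\<^sup>2\<close> and difference \<open>n\<close>. Taking
  \<open>a\<close> and \<open>b\<close> as separate variables lets the lemma match arguments written in any form.
\<close>
lemma theta_f_eq_theta_J:
  assumes "p \<noteq> 0" "z \<noteq> 0" "a = p * z" "b = p / z"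
  shows "theta_f a b = theta_J p z"
proof -
  have "a ^ nat (n * (n + 1) div 2) * b ^ nat (n * (n - 1) div 2) = p powi n\<^sup>2 * z powi n" for n :: int
  proof -
    define k where "k = n * (n + 1) div 2"
    define l where "l = n * (n - 1) div 2"
    have "2 * k = n * (n + 1)" "2 * l = n * (n - 1)"
      unfolding k_def l_def by simp_all
    then have "k + l = n\<^sup>2" "k - l = n"
      by (simp_all add: power2_eq_square algebra_simps)
    moreover have "0 \<le> n * (n + 1)" "0 \<le> n * (n - 1)"
      by (auto simp: zero_le_mult_iff)
    then have "0 \<le> k" "0 \<le> l" unfolding k_def l_def by simp_all
    ultimately show ?thesis
      using assms unfolding k_def[symmetric] l_def[symmetric]
      by (simp add: power_int_def[of a] power_int_def[of b] power_int_mult_distrib power_int_divide_distrib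
          flip: power_int_of_nat)
        (metis power_int_add power_int_diff mult.assoc mult.commute times_divide_eq_right)
  qed
  then show ?thesis unfolding theta_f_def theta_J_def by simp
qed

text \<open>
  The two exponents add up to \<open>n\<^sup>2\<close>, so only the term \<open>n = 0\<close> survives, with the value \<open>0 ^ 0 * 0 ^ 0\<close>.
\<close>
lemma theta_f_0_0: "theta_f 0 0 = 1"
proof -
  have "nat (n * (n + 1) div 2) \<noteq> 0 \<or> nat (n * (n - 1) div 2) \<noteq> 0" if "n \<noteq> 0" for n :: int
  proof -
    have "n * (n + 1) div 2 + n * (n - 1) div 2 = n\<^sup>2"
      by (simp add: power2_eq_square algebra_simps flip: div_plus_div_distrib_dvd_left)
    moreover have "n\<^sup>2 > 0" using that by simp
    ultimately show ?thesis by linarith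
  qed
  then have "theta_f 0 0 = (\<Sum>\<^sub>\<infinity>n\<in>{0::int}. 1)"
    unfolding theta_f_def by (intro infsum_cong_neutral) (auto simp: power_0_left)
  then show ?thesis by simp
qed

text \<open>
  The case \<open>x = -z/p\<close>, \<open>y = 1\<close> of \<open>theta_J_mult\<close>: then \<open>x y = x / y\<close>, so both products on the
  right-hand side are squares, and the coefficient \<open>p x\<close> is \<open>-z\<close>.
\<close>
lemma theta_square_difference:
  assumes "p \<noteq> 0" "norm p < 1" "z \<noteq> 0"
  shows "(theta_f (- (p * z)) (- (p ^ 3 / z)))\<^sup>2 - z * (theta_f (- (p / z)) (- (p ^ 3 * z)))\<^sup>2
    = theta_f (- z) (- (p\<^sup>2 / z)) * theta_phi p"
proof -
  have "theta_f (- (p * z)) (- (p ^ 3 / z)) = theta_J (p\<^sup>2) (- z / p)"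
    "theta_f (- (p / z)) (- (p ^ 3 * z)) = theta_J (p\<^sup>2) (inverse (- (p * z)))"
    "theta_f (- z) (- (p\<^sup>2 / z)) = theta_J p (- z / p)"
    "theta_phi p = theta_J p 1"
    unfolding theta_phi_def
    using assms by (intro theta_f_eq_theta_J; simp add: field_simps power2_eq_square power3_eq_cube)+
  moreover have "theta_J p (- z / p) * theta_J p 1
      = (theta_J (p\<^sup>2) (- z / p))\<^sup>2 - z * (theta_J (p\<^sup>2) (- (p * z)))\<^sup>2"
    using theta_J_mult[of p "- z / p" 1] assms by (simp add: power2_eq_square)
  ultimately show ?thesis by (simp only: theta_J_inverse)
qed

text \<open>
  In \<open>theta_J_mult\<close> with base \<open>p\<^sup>2\<close> and arguments \<open>-z/p\<close>, \<open>-p z\<close>, the quotient of the arguments is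
  the constant \<open>1/p\<^sup>2\<close>. The second factors \<open>J(p\<^sup>4, 1/p\<^sup>2)\<close> and \<open>J(p\<^sup>4, p\<^sup>2)\<close> therefore agree by
  reflection, both being \<open>\<psi>(p\<^sup>2)\<close>, and the first factors reassemble to \<open>J(p, -z)\<close> by the
  dissection.
\<close>
lemma theta_product:
  assumes "p \<noteq> 0" "norm p < 1" "z \<noteq> 0"
  shows "theta_f (- (p / z)) (- (p ^ 3 * z)) * theta_f (- (p * z)) (- (p ^ 3 / z))
    = theta_f (- (p / z)) (- (p * z)) * theta_psi (p\<^sup>2)"
proof -
  have "theta_f (- (p * z)) (- (p ^ 3 / z)) = theta_J (p\<^sup>2) (- z / p)"
    "theta_f (- (p / z)) (- (p ^ 3 * z)) = theta_J (p\<^sup>2) (inverse (- (p * z)))"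
    "theta_f (- (p / z)) (- (p * z)) = theta_J p (inverse (- z))"
    "theta_psi (p\<^sup>2) = theta_J (p ^ 4) (inverse (p\<^sup>2))"
    unfolding theta_psi_def
    using assms by (intro theta_f_eq_theta_J; simp add: field_simps power2_eq_square power3_eq_cube
        power4_eq_xxxx)+
  then have J: "theta_f (- (p * z)) (- (p ^ 3 / z)) = theta_J (p\<^sup>2) (- z / p)"
    "theta_f (- (p / z)) (- (p ^ 3 * z)) = theta_J (p\<^sup>2) (- (p * z))"
    "theta_f (- (p / z)) (- (p * z)) = theta_J p (- z)"
    "theta_psi (p\<^sup>2) = theta_J (p ^ 4) (p\<^sup>2)"
    by (simp_all only: theta_J_inverse)
  have p2: "norm (p\<^sup>2) < 1"
    using assms by (simp add: norm_power power_less_one_iff)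
  have "theta_J (p\<^sup>2) (- z / p) * theta_J (p\<^sup>2) (- (p * z))
      = theta_J (p ^ 4) (z\<^sup>2) * theta_J (p ^ 4) (inverse (p\<^sup>2))
        + p * (- z) * (theta_J (p ^ 4) (p ^ 4 * z\<^sup>2) * theta_J (p ^ 4) (p\<^sup>2))"
    using theta_J_mult[of "p\<^sup>2" "- z / p" "- (p * z)"] assms p2
    by (simp add: field_simps power2_eq_square power4_eq_xxxx)
  also have "\<dots> = theta_J p (- z) * theta_J (p ^ 4) (p\<^sup>2)"
  proof -
    have "theta_J p (- z) = theta_J (p ^ 4) (z\<^sup>2) + p * (- z) * theta_J (p ^ 4) (p ^ 4 * z\<^sup>2)"
      using theta_J_dissection[of p "- z"] assms by simp
    then show ?thesis
      unfolding theta_J_inverse by (simp only: algebra_simps)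
  qed
  finally show ?thesis unfolding J by (simp only: mult.commute)
qed

section \<open>The quotient identities\<close>

lemma theta_quotient:
  fixes p z :: complex
  assumes "p \<noteq> 0" "norm p < 1" "z \<noteq> 0"
  defines "C \<equiv> theta_f (- (p / z)) (- (p ^ 3 * z)) / theta_f (- (p * z)) (- (p ^ 3 / z))"
  shows "1 / C - z * C = theta_f (- z) (- (p\<^sup>2 / z)) * theta_phi p
    / (theta_f (- (p / z)) (- (p * z)) * theta_psi (p\<^sup>2))"
proof -
  define A where "A = theta_f (- (p / z)) (- (p ^ 3 * z))"
  define B where "B = theta_f (- (p * z)) (- (p ^ 3 / z))"
  \<comment> \<open>If \<open>A\<close> or \<open>B\<close> is zero, both sides are 0 because \<open>x / 0 = 0\<close>.\<close>
  have "1 / C - z * C = (B\<^sup>2 - z * A\<^sup>2) / (A * B)"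
    unfolding C_def A_def[symmetric] B_def[symmetric]
    by (cases "A = 0"; cases "B = 0") (simp_all add: field_simps power2_eq_square)
  then show ?thesis
    unfolding A_def B_def
    using theta_square_difference[OF assms(1-3)] theta_product[OF assms(1-3)] by simp
qed

text \<open>
  The case \<open>p = t ^ 15\<close>, \<open>z = t ^ m\<close>, with \<open>j = (15 - m)/2\<close> and \<open>k = (15 + m)/2\<close>. At \<open>t = 0\<close>, where
  \<open>p / z\<close> no longer represents a power of \<open>t\<close>, every theta value is \<open>f(0, 0) = 1\<close>.
\<close>
lemma theta_quotient_powers:
  fixes t :: complex
  assumes "norm t < 1" "j + k = 15" "k = j + m"
    and "j + j' = 30" "k + k' = 30" "m + m' = 30"
    and "m > 0" "j > 0"
  defines "C \<equiv> theta_f (- ((t\<^sup>2) ^ j)) (- ((t\<^sup>2) ^ j'))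
    / theta_f (- ((t\<^sup>2) ^ k)) (- ((t\<^sup>2) ^ k'))"
  shows "1 / C - t ^ m * C = theta_f (- (t ^ m)) (- (t ^ m')) * theta_phi (t ^ 15)
    / (theta_f (- ((t\<^sup>2) ^ j)) (- ((t\<^sup>2) ^ k)) * theta_psi ((t\<^sup>2) ^ 15))"
proof (cases "t = 0")
  case True
  then show ?thesis
    using assms by (simp add: C_def theta_phi_def theta_psi_def theta_f_0_0 power_0_left)
next
  case False
  have exps: "2 * j + m = 15" "15 + m = 2 * k" "2 * j' = 45 + m" "m + k' * 2 = 45"
    "m + m' = 30"
    using assms by auto
  have "t ^ 15 / t ^ m = (t\<^sup>2) ^ j"
    using False by (simp add: field_simps flip: exps(1) power_mult power_add)
  moreover have "t ^ 15 * t ^ m = (t\<^sup>2) ^ k"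
    by (simp flip: power_mult power_add exps(2))
  moreover have "(t ^ 15) ^ 3 * t ^ m = (t\<^sup>2) ^ j'"
    by (simp add: exps(3) flip: power_mult power_add)
  moreover have "(t ^ 15) ^ 3 / t ^ m = (t\<^sup>2) ^ k'"
    using False by (simp add: field_simps exps(4) flip: power_mult power_add)
  moreover have "(t ^ 15)\<^sup>2 / t ^ m = t ^ m'"
    using False by (simp add: field_simps exps(5) flip: power_mult power_add)
  moreover have "(t ^ 15)\<^sup>2 = (t\<^sup>2) ^ 15"
    by (simp flip: power_mult)
  moreover have "norm (t ^ 15) < 1"
    using assms by (simp add: norm_power power_less_one_iff)
  ultimately show ?thesis
    using theta_quotient[of "t ^ 15" "t ^ m"] False unfolding C_def by simp
qed

theorem theorem3p3:
  fixes q s \<epsilon> :: complex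
  assumes "norm q < 1"
    and "s ^ 2 = q"
    and "\<epsilon> = 1 \<or> \<epsilon> = - 1"
  shows "(1 / C1 q - \<epsilon> * s * C1 q =
      theta_f (- (\<epsilon> * s)) (- (\<epsilon> * s ^ 29)) * theta_phi (\<epsilon> * s ^ 15)
        / (theta_f (- (q ^ 7)) (- (q ^ 8)) * theta_psi (q ^ 15)))
    \<and> (1 / C2 q - \<epsilon> * s ^ 3 * C2 q =
      theta_f (- (\<epsilon> * s ^ 3)) (- (\<epsilon> * s ^ 27)) * theta_phi (\<epsilon> * s ^ 15)
        / (theta_f (- (q ^ 6)) (- (q ^ 9)) * theta_psi (q ^ 15)))
    \<and> (1 / C3 q - \<epsilon> * s ^ 5 * C3 q =
      theta_f (- (\<epsilon> * s ^ 5)) (- (\<epsilon> * s ^ 25)) * theta_phi (\<epsilon> * s ^ 15)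
        / (theta_f (- (q ^ 5)) (- (q ^ 10)) * theta_psi (q ^ 15)))
    \<and> (1 / C4 q - \<epsilon> * s ^ 7 * C4 q =
      theta_f (- (\<epsilon> * s ^ 7)) (- (\<epsilon> * s ^ 23)) * theta_phi (\<epsilon> * s ^ 15)
        / (theta_f (- (q ^ 4)) (- (q ^ 11)) * theta_psi (q ^ 15)))
    \<and> (1 / C5 q - \<epsilon> * s ^ 9 * C5 q =
      theta_f (- (\<epsilon> * s ^ 9)) (- (\<epsilon> * s ^ 21)) * theta_phi (\<epsilon> * s ^ 15)
        / (theta_f (- (q ^ 3)) (- (q ^ 12)) * theta_psi (q ^ 15)))
    \<and> (1 / C6 q - \<epsilon> * s ^ 11 * C6 q =
      theta_f (- (\<epsilon> * s ^ 11)) (- (\<epsilon> * s ^ 19)) * theta_phi (\<epsilon> * s ^ 15)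
        / (theta_f (- (q ^ 2)) (- (q ^ 13)) * theta_psi (q ^ 15)))
    \<and> (1 / C7 q - \<epsilon> * s ^ 13 * C7 q =
      theta_f (- (\<epsilon> * s ^ 13)) (- (\<epsilon> * s ^ 17)) * theta_phi (\<epsilon> * s ^ 15)
        / (theta_f (- q) (- (q ^ 14)) * theta_psi (q ^ 15)))"
proof -
  define t where "t = \<epsilon> * s"
  \<comment> \<open>An odd power of \<open>\<epsilon>\<close> is \<open>\<epsilon>\<close>, so the sign is absorbed into the choice of square root.\<close>
  have q: "q = t\<^sup>2" and odd_powers:
    "\<epsilon> * s = t" "\<epsilon> * s ^ 3 = t ^ 3" "\<epsilon> * s ^ 5 = t ^ 5" "\<epsilon> * s ^ 7 = t ^ 7"
    "\<epsilon> * s ^ 9 = t ^ 9" "\<epsilon> * s ^ 11 = t ^ 11" "\<epsilon> * s ^ 13 = t ^ 13" "\<epsilon> * s ^ 15 = t ^ 15"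
    "\<epsilon> * s ^ 17 = t ^ 17" "\<epsilon> * s ^ 19 = t ^ 19" "\<epsilon> * s ^ 21 = t ^ 21" "\<epsilon> * s ^ 23 = t ^ 23"
    "\<epsilon> * s ^ 25 = t ^ 25" "\<epsilon> * s ^ 27 = t ^ 27" "\<epsilon> * s ^ 29 = t ^ 29"
    using assms(2,3) by (auto simp: t_def power_mult_distrib)
  have "(norm t)\<^sup>2 < 1"
    using assms(1) q by (simp add: norm_power)
  then have t: "norm t < 1"
    by (simp add: power_less_one_iff)
  show ?thesis
    unfolding odd_powers unfolding C1_def C2_def C3_def C4_def C5_def C6_def C7_def q
    by (intro conjI
        theta_quotient_powers[OF t, of 7 8 1 23 22 29, unfolded power_one_right]
        theta_quotient_powers[OF t, of 6 9 3 24 21 27]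
        theta_quotient_powers[OF t, of 5 10 5 25 20 25]
        theta_quotient_powers[OF t, of 4 11 7 26 19 23]
        theta_quotient_powers[OF t, of 3 12 9 27 18 21]
        theta_quotient_powers[OF t, of 2 13 11 28 17 19]
        theta_quotient_powers[OF t, of 1 14 13 29 16 17, unfolded power_one_right])
      simp_all
qed

end
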